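(* Let $X$ be a compact topological space endowed with two continuous functions $\vec\varphi:X\to\mathbb{R}^n$, $\vec\psi:X\to\mathbb{R}^n$. Let $k\in\mathbb{Z}$ and let homology coefficients be taken in an Abelian group $G$. Then $$d_T\left(H_k^{(X,\vec\varphi)},H_k^{(X,\vec\psi)}\right)\le\|\vec\varphi-\vec\psi\|_\infty.$$
   Context: For $\vec u,\vec v\in\mathbb{R}^n$ write $\vec u\preceq\vec v$ (resp. $\vec u\prec\vec v$) if $u_i\le v_i$ (resp. $u_i<v_i$) for all $i$. Let $\Delta^+=\{(\vec u,\vec v)\in\mathbb{R}^n\times\mathbb{R}^n:\vec u\prec\vec v\}$. For a function $\vec\varphi:X\to\mathbb{R}^n$ put $X\langle\vec\varphi\preceq\vec u\rangle=\{x\in X:\varphi_i(x)\le u_i,\ i=1,\dots,n\}$. $\mathbb{R}^n$ carries the max-norm $\|\vec u\|_\infty=\max_i|u_i|$, and for $X$ compact and $\vec\varphi$ continuous, $\|\vec\varphi\|_\infty=\max_{x\in X}\|\vec\varphi(x)\|_\infty$. Persistent homology group: $H_k$ denotes $k$th (singular) homology with coefficients in $G$. For $(\vec u,\vec v)\in\Delta^+$, $H_k^{(X,\vec\varphi)}(\vec u,\vec v)$ is the image of the homomorphism $H_k(X\langle\vec\varphi\preceq\vec u\rangle)\to H_k(X\langle\vec\varphi\preceq\vec v\rangle)$ induced by inclusion; $H_k^{(X,\vec\varphi)}$ denotes the function $(\vec u,\vec v)\mapsto H_k^{(X,\vec\varphi)}(\vec u,\vec v)$ on $\Delta^+$. Definition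 of $d_T$: for pairs $(X,\vec\varphi)$, $(Y,\vec\psi)$ of topological spaces with continuous $\mathbb{R}^n$-valued functions, let $E$ be the set of all real $\epsilon\ge 0$ such that, with $\vec\epsilon=(\epsilon,\dots,\epsilon)\in\mathbb{R}^n$, for every $(\vec u,\vec v)\in\Delta^+$: (1) there is a surjective homomorphism from a subgroup of $H_k^{(X,\vec\varphi)}(\vec u,\vec v)$ onto $H_k^{(Y,\vec\psi)}(\vec u-\vec\epsilon,\vec v+\vec\epsilon)$; and (2) there is a surjective homomorphism from a subgroup of $H_k^{(Y,\vec\psi)}(\vec u,\vec v)$ onto $H_k^{(X,\vec\varphi)}(\vec u-\vec\epsilon,\vec v+\vec\epsilon)$. Then $d_T\left(H_k^{(X,\vec\varphi)},H_k^{(Y,\vec\psi)}\right)=\inf E$ if $E\neq\emptyset$, and $=\infty$ otherwise. *)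

theory Defs
  imports "HOL-Homology.Homology" "HOL-Library.Extended_Real"
begin

section \<open>Singular homology with coefficients in an abelian group\<close>

text \<open>
  HOL-Homology provides integral singular homology only. The chain group \<open>C\<^sub>k(X; G)\<close> is the
  direct sum of copies of \<open>G\<close> indexed by the singular \<open>k\<close>-simplices of \<open>X\<close>, here the finitely
  supported families of elements of \<open>G\<close>; it is trivial for \<open>k < 0\<close>. The operation of \<open>G\<close> is
  written multiplicatively, as usual in HOL-Algebra.
\<close>

definition gchain_group ::
    "('g, 'm) monoid_scheme \<Rightarrow> int \<Rightarrow> 'a topology \<Rightarrow> (((nat \<Rightarrow> real) \<Rightarrow> 'a) \<Rightarrow> 'g) monoid" where
  "gchain_group G k X =
    \<lparr>carrier = {c. (\<forall>\<sigma>. c \<sigma> \<in> carrier G) \<and> finite {\<sigma>. c \<sigma> \<noteq> \<one>\<^bsub>G\<^esub>} \<and>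
                  (\<forall>\<sigma>. c \<sigma> \<noteq> \<one>\<^bsub>G\<^esub> \<longrightarrow> 0 \<le> k \<and> singular_simplex (nat k) X \<sigma>)},
     monoid.mult = (\<lambda>c d \<sigma>. c \<sigma> \<otimes>\<^bsub>G\<^esub> d \<sigma>),
     one = (\<lambda>\<sigma>. \<one>\<^bsub>G\<^esub>)\<rparr>"

text \<open>
  The homomorphism \<open>D \<otimes> id\<^sub>G\<close> for a homomorphism \<open>D\<close> of integral singular chains: in additive
  notation, the coefficient of \<open>\<tau>\<close> in the image of \<open>\<Sum>\<^sub>\<sigma> c\<^sub>\<sigma> \<sigma>\<close> is \<open>\<Sum>\<^sub>\<sigma> d\<^sub>\<sigma>\<^sub>\<tau> c\<^sub>\<sigma>\<close>, where the
  integer \<open>d\<^sub>\<sigma>\<^sub>\<tau>\<close> is the coefficient of \<open>\<tau>\<close> in \<open>D \<sigma>\<close>.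
\<close>

definition extend_coeffs ::
    "('g, 'm) monoid_scheme \<Rightarrow> ('a chain \<Rightarrow> 'b chain) \<Rightarrow>
     (((nat \<Rightarrow> real) \<Rightarrow> 'a) \<Rightarrow> 'g) \<Rightarrow> (((nat \<Rightarrow> real) \<Rightarrow> 'b) \<Rightarrow> 'g)" where
  "extend_coeffs G D c =
    (\<lambda>\<tau>. \<Otimes>\<^bsub>G\<^esub>\<sigma>\<in>{\<sigma>. c \<sigma> \<noteq> \<one>\<^bsub>G\<^esub>}. c \<sigma> [^]\<^bsub>G\<^esub> Poly_Mapping.lookup (D (frag_of \<sigma>)) \<tau>)"

definition gboundary ::
    "('g, 'm) monoid_scheme \<Rightarrow> int \<Rightarrow> (((nat \<Rightarrow> real) \<Rightarrow> 'a) \<Rightarrow> 'g) \<Rightarrow> (((nat \<Rightarrow> real) \<Rightarrow> 'a) \<Rightarrow> 'g)" where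
  "gboundary G k = extend_coeffs G (chain_boundary (nat k))"

definition gcycles ::
    "('g, 'm) monoid_scheme \<Rightarrow> int \<Rightarrow> 'a topology \<Rightarrow> (((nat \<Rightarrow> real) \<Rightarrow> 'a) \<Rightarrow> 'g) set" where
  "gcycles G k X = {c \<in> carrier (gchain_group G k X). gboundary G k c = (\<lambda>\<sigma>. \<one>\<^bsub>G\<^esub>)}"

definition gboundaries ::
    "('g, 'm) monoid_scheme \<Rightarrow> int \<Rightarrow> 'a topology \<Rightarrow> (((nat \<Rightarrow> real) \<Rightarrow> 'a) \<Rightarrow> 'g) set" where
  "gboundaries G k X = gboundary G (k + 1) ` carrier (gchain_group G (k + 1) X)"

definition ghomology_group ::
    "('g, 'm) monoid_scheme \<Rightarrow> int \<Rightarrow> 'a topology \<Rightarrow> (((nat \<Rightarrow> real) \<Rightarrow> 'a) \<Rightarrow> 'g) set monoid" where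
  "ghomology_group G k X =
    ((gchain_group G k X)\<lparr>carrier := gcycles G k X\<rparr>) Mod (gboundaries G k X)"

text \<open>
  The homomorphism \<open>H\<^sub>k(X; G) \<rightarrow> H\<^sub>k(Y; G)\<close> induced by a continuous map \<open>f\<close>. A homology class is a
  coset \<open>A\<close> of the boundaries in the cycles; the product of the boundaries of \<open>Y\<close> with the image of
  \<open>A\<close> under the chain map is the class of the image of any representative.
\<close>

definition ghom_induced ::
    "('g, 'm) monoid_scheme \<Rightarrow> int \<Rightarrow> 'b topology \<Rightarrow> ('a \<Rightarrow> 'b) \<Rightarrow>
     (((nat \<Rightarrow> real) \<Rightarrow> 'a) \<Rightarrow> 'g) set \<Rightarrow> (((nat \<Rightarrow> real) \<Rightarrow> 'b) \<Rightarrow> 'g) set" where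
  "ghom_induced G k Y f A =
    gboundaries G k Y <#>\<^bsub>gchain_group G k Y\<^esub> (extend_coeffs G (chain_map (nat k) f) ` A)"


section \<open>Persistent homology groups\<close>

text \<open>The strict order on \<open>real ^ 'n\<close> in the library is not the componentwise one.\<close>

definition Delta_plus :: "((real ^ 'n) \<times> (real ^ 'n)) set" where
  "Delta_plus = {(u, v). \<forall>i. u $ i < v $ i}"

definition sublevel :: "'a topology \<Rightarrow> ('a \<Rightarrow> real ^ 'n) \<Rightarrow> real ^ 'n \<Rightarrow> 'a topology" where
  "sublevel X \<phi> u = subtopology X {x \<in> topspace X. \<forall>i. \<phi> x $ i \<le> u $ i}"

text \<open>Only the values at pairs in \<^const>\<open>Delta_plus\<close> are meaningful.\<close>

definition persistent_homology ::
    "('g, 'm) monoid_scheme \<Rightarrow> int \<Rightarrow> 'a topology \<Rightarrow> ('a \<Rightarrow> real ^ 'n) \<Rightarrow>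
     (real ^ 'n) \<times> (real ^ 'n) \<Rightarrow> (((nat \<Rightarrow> real) \<Rightarrow> 'a) \<Rightarrow> 'g) set monoid" where
  "persistent_homology G k X \<phi> = (\<lambda>(u, v).
    (ghomology_group G k (sublevel X \<phi> v))
      \<lparr>carrier := ghom_induced G k (sublevel X \<phi> v) id ` carrier (ghomology_group G k (sublevel X \<phi> u))\<rparr>)"


section \<open>The distance and the max-norm\<close>

definition subgroup_surjects :: "('c, 'm) monoid_scheme \<Rightarrow> ('d, 'l) monoid_scheme \<Rightarrow> bool" where
  "subgroup_surjects A B \<longleftrightarrow> (\<exists>S f. subgroup S A \<and> f \<in> epi (A\<lparr>carrier := S\<rparr>) B)"

definition dT_set ::
    "((real ^ 'n) \<times> (real ^ 'n) \<Rightarrow> 'c monoid) \<Rightarrow> ((real ^ 'n) \<times> (real ^ 'n) \<Rightarrow> 'd monoid) \<Rightarrow> real set" where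
  "dT_set H K = {\<epsilon>. 0 \<le> \<epsilon> \<and> (\<forall>(u, v)\<in>Delta_plus.
      subgroup_surjects (H (u, v)) (K (u - vec \<epsilon>, v + vec \<epsilon>)) \<and>
      subgroup_surjects (K (u, v)) (H (u - vec \<epsilon>, v + vec \<epsilon>)))}"

definition dT ::
    "((real ^ 'n) \<times> (real ^ 'n) \<Rightarrow> 'c monoid) \<Rightarrow> ((real ^ 'n) \<times> (real ^ 'n) \<Rightarrow> 'd monoid) \<Rightarrow> ereal" where
  "dT H K = (if dT_set H K \<noteq> {} then ereal (Inf (dT_set H K)) else \<infinity>)"

text \<open>
  \<^const>\<open>infnorm\<close> is the max-norm on \<open>real ^ 'n\<close>. For compact \<open>X\<close> and continuous \<open>f\<close> the supremum
  is attained; for empty \<open>X\<close> the norm is \<open>0\<close>, as the function space is trivial.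
\<close>

definition maxnorm_on :: "'a topology \<Rightarrow> ('a \<Rightarrow> real ^ 'n) \<Rightarrow> real" where
  "maxnorm_on X f = (if topspace X = {} then 0 else (SUP x\<in>topspace X. infnorm (f x)))"

end

(* Put \<epsilon> = \<parallel>\<phi> - \<psi>\<parallel>. Then {\<psi> \<le> u - \<epsilon>} \<subseteq> {\<phi> \<le> u} \<subseteq> {\<phi> \<le> v} \<subseteq> {\<psi> \<le> v + \<epsilon>}, so the map in homology from the
   first to the last of these sets factors through the two in the middle. The image of the first
   set in the homology of the third is therefore a subgroup of the persistent homology of \<phi> at
   (u, v), and the last inclusion maps it onto the persistent homology of \<psi> at (u - \<epsilon>, v + \<epsilon>).
   Hence \<epsilon> lies in the set whose infimum is the distance. *)
theory Submission
  imports Defs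
begin

section \<open>Chain groups with coefficients and homomorphisms between them\<close>

lemma carrier_gchain_group:
  "c \<in> carrier (gchain_group G k X) \<longleftrightarrow>
     (\<forall>\<sigma>. c \<sigma> \<in> carrier G) \<and> finite {\<sigma>. c \<sigma> \<noteq> \<one>\<^bsub>G\<^esub>} \<and>
     (\<forall>\<sigma>. c \<sigma> \<noteq> \<one>\<^bsub>G\<^esub> \<longrightarrow> 0 \<le> k \<and> singular_simplex (nat k) X \<sigma>)"
  by (simp add: gchain_group_def)

lemma mult_gchain_group [simp]: "c \<otimes>\<^bsub>gchain_group G k X\<^esub> d = (\<lambda>\<sigma>. c \<sigma> \<otimes>\<^bsub>G\<^esub> d \<sigma>)"
  by (simp add: gchain_group_def)

lemma one_gchain_group [simp]: "\<one>\<^bsub>gchain_group G k X\<^esub> = (\<lambda>\<sigma>. \<one>\<^bsub>G\<^esub>)"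
  by (simp add: gchain_group_def)

lemma comm_group_gchain_group:
  fixes G (structure)
  assumes "comm_group G"
  shows "comm_group (gchain_group G k X)"
proof -
  interpret comm_group G by fact
  \<comment> \<open>A pointwise inverse has the same support as the chain, so finiteness and the
    condition on simplices carry over.\<close>
  have inv_eq_one: "inv (c \<sigma>) = \<one> \<longleftrightarrow> c \<sigma> = \<one>" if "\<forall>\<sigma>. c \<sigma> \<in> carrier G" for c :: "((nat \<Rightarrow> real) \<Rightarrow> 'c) \<Rightarrow> 'a" and \<sigma>
    using that by (metis inv_inv inv_one)
  show ?thesis
  proof (rule comm_groupI)
    fix c d assume c: "c \<in> carrier (gchain_group G k X)" and d: "d \<in> carrier (gchain_group G k X)"
    have supp: "{\<sigma>. c \<sigma> \<otimes> d \<sigma> \<noteq> \<one>} \<subseteq> {\<sigma>. c \<sigma> \<noteq> \<one>} \<union> {\<sigma>. d \<sigma> \<noteq> \<one>}"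
      by auto
    show "c \<otimes>\<^bsub>gchain_group G k X\<^esub> d \<in> carrier (gchain_group G k X)"
      using c d finite_subset[OF supp] supp unfolding carrier_gchain_group mult_gchain_group by blast
  next
    fix c assume c: "c \<in> carrier (gchain_group G k X)"
    then have "(\<lambda>\<sigma>. inv (c \<sigma>)) \<in> carrier (gchain_group G k X)"
      by (simp add: carrier_gchain_group inv_eq_one)
    moreover have "(\<lambda>\<sigma>. inv (c \<sigma>)) \<otimes>\<^bsub>gchain_group G k X\<^esub> c = \<one>\<^bsub>gchain_group G k X\<^esub>"
      using c by (simp add: carrier_gchain_group)
    ultimately show "\<exists>d\<in>carrier (gchain_group G k X).
        d \<otimes>\<^bsub>gchain_group G k X\<^esub> c = \<one>\<^bsub>gchain_group G k X\<^esub>"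
      by blast
  qed (simp_all add: carrier_gchain_group m_ac)
qed

lemma group_gchain_group: "comm_group G \<Longrightarrow> group (gchain_group G k X)"
  by (intro comm_group.axioms comm_group_gchain_group)

text \<open>A chain is a function on all maps into the type of points, so a chain of a smaller
  subspace is literally a chain of a larger one. Inclusions therefore act on chains as the identity,
  without any embedding.\<close>

lemma carrier_gchain_group_mono:
  "S \<subseteq> T \<Longrightarrow>
   carrier (gchain_group G k (subtopology X S)) \<subseteq> carrier (gchain_group G k (subtopology X T))"
  unfolding subset_iff carrier_gchain_group singular_simplex_subtopology by blast

text \<open>Only the values \<open>D (frag_of \<sigma>)\<close> enter \<open>extend_coeffs\<close>,
  so \<open>D\<close> is constrained on simplices alone. Multiplicativity comes from the
  coefficients: integer powers distribute over products in a commutative group.\<close>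

lemma extend_coeffs_hom:
  fixes G (structure)
  assumes "comm_group G"
    and D: "\<And>\<sigma> \<tau>. \<lbrakk>0 \<le> k; singular_simplex (nat k) X \<sigma>; \<tau> \<in> Poly_Mapping.keys (D (frag_of \<sigma>))\<rbrakk>
              \<Longrightarrow> 0 \<le> l \<and> singular_simplex (nat l) Y \<tau>"
  shows "extend_coeffs G D \<in> hom (gchain_group G k X) (gchain_group G l Y)"
proof -
  interpret comm_group G by fact
  let ?n = "\<lambda>\<sigma> \<tau>. Poly_Mapping.lookup (D (frag_of \<sigma>)) \<tau>"
  \<comment> \<open>The defining product runs over the support, which differs for \<open>c\<close>,
    \<open>d\<close> and their product. Padding with trivial factors allows one common finite index
    set.\<close>
  have extend: "extend_coeffs G D c \<tau> = (\<Otimes>\<sigma>\<in>A. c \<sigma> [^] ?n \<sigma> \<tau>)"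
    if "c \<in> carrier (gchain_group G k X)" "finite A" "{\<sigma>. c \<sigma> \<noteq> \<one>} \<subseteq> A" for c \<tau> A
    unfolding extend_coeffs_def
    by (rule finprod_mono_neutral_cong_left) (use that in \<open>auto simp: carrier_gchain_group\<close>)
  show ?thesis
  proof (rule homI)
    fix c assume c: "c \<in> carrier (gchain_group G k X)"
    let ?K = "\<Union>\<sigma>\<in>{\<sigma>. c \<sigma> \<noteq> \<one>}. Poly_Mapping.keys (D (frag_of \<sigma>))"
    have supp: "\<tau> \<in> ?K" if "extend_coeffs G D c \<tau> \<noteq> \<one>" for \<tau>
    proof (rule ccontr)
      assume "\<tau> \<notin> ?K"
      then have "extend_coeffs G D c \<tau> = \<one>"
        unfolding extend_coeffs_def using c
          by (intro finprod_one_eqI) (auto simp: in_keys_iff carrier_gchain_group)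
      with that show False by simp
    qed
    have "finite ?K"
      using c by (simp add: carrier_gchain_group)
    then have "finite {\<tau>. extend_coeffs G D c \<tau> \<noteq> \<one>}"
      by (rule finite_subset[rotated]) (use supp in blast)
    moreover have "extend_coeffs G D c \<tau> \<in> carrier G" for \<tau>
      unfolding extend_coeffs_def using c by (intro finprod_closed) (auto simp: carrier_gchain_group)
    moreover have "0 \<le> l \<and> singular_simplex (nat l) Y \<tau>" if "extend_coeffs G D c \<tau> \<noteq> \<one>" for \<tau>
      using supp[OF that] c D by (auto simp: carrier_gchain_group)
    ultimately show "extend_coeffs G D c \<in> carrier (gchain_group G l Y)"
      by (simp add: carrier_gchain_group)
  next
    fix c d assume c: "c \<in> carrier (gchain_group G k X)" and d: "d \<in> carrier (gchain_group G k X)"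
    let ?A = "{\<sigma>. c \<sigma> \<noteq> \<one>} \<union> {\<sigma>. d \<sigma> \<noteq> \<one>}"
    have A: "finite ?A"
      using c d by (simp add: carrier_gchain_group)
    have cd: "(\<lambda>\<sigma>. c \<sigma> \<otimes> d \<sigma>) \<in> carrier (gchain_group G k X)"
      using monoid.m_closed[OF group.is_monoid[OF group_gchain_group[OF \<open>comm_group G\<close>]] c d]
      by simp
    have "extend_coeffs G D (\<lambda>\<sigma>. c \<sigma> \<otimes> d \<sigma>) \<tau> =
        extend_coeffs G D c \<tau> \<otimes> extend_coeffs G D d \<tau>" for \<tau>
    proof -
      have "extend_coeffs G D (\<lambda>\<sigma>. c \<sigma> \<otimes> d \<sigma>) \<tau> = (\<Otimes>\<sigma>\<in>?A. (c \<sigma> \<otimes> d \<sigma>) [^] ?n \<sigma> \<tau>)"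
        by (rule extend[OF cd A]) auto
      also have "\<dots> = (\<Otimes>\<sigma>\<in>?A. c \<sigma> [^] ?n \<sigma> \<tau> \<otimes> d \<sigma> [^] ?n \<sigma> \<tau>)"
        using c d by (intro finprod_cong') (auto simp: carrier_gchain_group int_pow_distrib)
      also have "\<dots> = (\<Otimes>\<sigma>\<in>?A. c \<sigma> [^] ?n \<sigma> \<tau>) \<otimes> (\<Otimes>\<sigma>\<in>?A. d \<sigma> [^] ?n \<sigma> \<tau>)"
        using c d by (intro finprod_multf) (auto simp: carrier_gchain_group)
      also have "\<dots> = extend_coeffs G D c \<tau> \<otimes> extend_coeffs G D d \<tau>"
        using extend[OF c A] extend[OF d A] by simp
      finally show ?thesis .
    qed
    then show "extend_coeffs G D (c \<otimes>\<^bsub>gchain_group G k X\<^esub> d) =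
        extend_coeffs G D c \<otimes>\<^bsub>gchain_group G l Y\<^esub> extend_coeffs G D d"
      by (simp add: fun_eq_iff)
  qed
qed

lemma gboundary_hom:
  assumes "comm_group G"
  shows "gboundary G k \<in> hom (gchain_group G k X) (gchain_group G (k - 1) X)"
  unfolding gboundary_def
proof (rule extend_coeffs_hom[OF assms])
  fix \<sigma> \<tau>
  assume *: "0 \<le> k" "singular_simplex (nat k) X \<sigma>"
    "\<tau> \<in> Poly_Mapping.keys (chain_boundary (nat k) (frag_of \<sigma>))"
  \<comment> \<open>In degree 0 the boundary is 0 and has no keys. Excluding this case keeps the
    truncated subtraction \<open>nat k - Suc 0\<close> equal to \<open>nat (k - 1)\<close>.\<close>
  then have "k \<noteq> 0"
    by (auto simp: chain_boundary_def)
  moreover have "singular_chain (nat k - Suc 0) X (chain_boundary (nat k) (frag_of \<sigma>))"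
    using * by (simp add: singular_chain_boundary singular_chain_of)
  ultimately show "0 \<le> k - 1 \<and> singular_simplex (nat (k - 1)) X \<tau>"
    using * by (auto simp: singular_chain_def nat_diff_distrib)
qed

lemma extend_coeffs_chain_map_id:
  fixes G (structure)
  assumes "comm_group G" and c: "c \<in> carrier (gchain_group G k X)"
  shows "extend_coeffs G (chain_map (nat k) id) c = c"
proof
  interpret comm_group G by fact
  fix \<tau>
  let ?A = "{\<sigma>. c \<sigma> \<noteq> \<one>}"
  have "extend_coeffs G (chain_map (nat k) id) c \<tau> = (\<Otimes>\<sigma>\<in>?A. if \<tau> = \<sigma> then c \<sigma> else \<one>)"
    unfolding extend_coeffs_def
  proof (rule finprod_cong')
    fix \<sigma> assume "\<sigma> \<in> ?A"
    then have "singular_simplex (nat k) X \<sigma>"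
      using c by (simp add: carrier_gchain_group)
    \<comment> \<open>The default rule \<open>simplex_map_id\<close> would leave a restriction to
      the standard simplex. The general rule uses that a singular simplex is extensional and returns
      \<sigma> itself.\<close>
    then have "chain_map (nat k) id (frag_of \<sigma>) = frag_of \<sigma>"
      by (simp add: simplex_map_id_gen del: simplex_map_id)
    then show "c \<sigma> [^] Poly_Mapping.lookup (chain_map (nat k) id (frag_of \<sigma>)) \<tau> =
        (if \<tau> = \<sigma> then c \<sigma> else \<one>)"
      using c by (simp add: carrier_gchain_group lookup_single)
  qed (use c in \<open>auto simp: carrier_gchain_group\<close>)
  also have "\<dots> = c \<tau>"
  proof (cases "\<tau> \<in> ?A")
    case True
    then show ?thesis
      using c by (subst finprod_singleton) (auto simp: carrier_gchain_group)
  next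
    case False
    then show ?thesis
      by (auto intro!: finprod_one_eqI)
  qed
  finally show "extend_coeffs G (chain_map (nat k) id) c \<tau> = c \<tau>" .
qed

section \<open>Cycles and boundaries of a space and of its subspaces\<close>

lemma subgroup_gcycles:
  assumes "comm_group G"
  shows "subgroup (gcycles G k X) (gchain_group G k X)"
proof -
  interpret group_hom "gchain_group G k X" "gchain_group G (k - 1) X" "gboundary G k"
    by (intro group_hom.intro group_hom_axioms.intro group_gchain_group gboundary_hom assms)
  show ?thesis
    using subgroup_kernel by (simp add: gcycles_def kernel_def)
qed

lemma subgroup_gboundaries:
  assumes "comm_group G"
  shows "subgroup (gboundaries G k X) (gchain_group G k X)"
proof -
  interpret group_hom "gchain_group G (k + 1) X" "gchain_group G k X" "gboundary G (k + 1)"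
    using gboundary_hom[OF assms, of "k + 1"]
    by (intro group_hom.intro group_hom_axioms.intro group_gchain_group assms) simp
  show ?thesis
    using img_is_subgroup by (simp add: gboundaries_def)
qed

lemma gcycles_mono:
  "S \<subseteq> T \<Longrightarrow> gcycles G k (subtopology X S) \<subseteq> gcycles G k (subtopology X T)"
  using carrier_gchain_group_mono unfolding gcycles_def by blast

lemma gboundaries_mono:
  "S \<subseteq> T \<Longrightarrow> gboundaries G k (subtopology X S) \<subseteq> gboundaries G k (subtopology X T)"
  unfolding gboundaries_def by (intro image_mono carrier_gchain_group_mono)

text \<open>This places the cycles and boundaries of all sublevel sets inside the chain group of the
  largest one, where they can be compared as subgroups of a single group.\<close>

lemma subgroup_gchain_group_subtopology:
  assumes "comm_group G" and "S \<subseteq> T"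
    and H: "subgroup H (gchain_group G k (subtopology X S))"
  shows "subgroup H (gchain_group G k (subtopology X T))"
proof -
  have "subgroup (carrier (gchain_group G k (subtopology X S))) (gchain_group G k (subtopology X T))"
  proof -
    have "group_hom (gchain_group G k (subtopology X S)) (gchain_group G k (subtopology X T)) (\<lambda>c. c)"
      using carrier_gchain_group_mono[OF \<open>S \<subseteq> T\<close>, of G k X]
      by (intro group_hom.intro group_hom_axioms.intro group_gchain_group assms) (auto simp: hom_def)
    from group_hom.img_is_subgroup[OF this] show ?thesis
      by simp
  qed
  \<comment> \<open>The operation and the unit depend on \<open>G\<close> only; the two chain groups
    differ just in their carriers.\<close>
  moreover have "(gchain_group G k (subtopology X T))
      \<lparr>carrier := carrier (gchain_group G k (subtopology X S))\<rparr> = gchain_group G k (subtopology X S)"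
    by (simp add: gchain_group_def)
  ultimately show ?thesis
    using H group.incl_subgroup[OF group_gchain_group[OF assms(1)]] by metis
qed

section \<open>Cosets, persistent groups as subquotients of chains, and surjections between
  them\<close>

lemma (in group) set_mult_r_coset_absorb:
  assumes N: "subgroup N G" and M: "subgroup M G" and "N \<subseteq> M" and z: "z \<in> carrier G"
  shows "M <#> (N #> z) = M #> z"
proof -
  \<comment> \<open>Once \<open>M\<close> absorbs \<open>N\<close>, associativity shows that
    \<open>A \<mapsto> M <#> A\<close> is the projection from cosets of \<open>N\<close> to cosets
    of \<open>M\<close>.\<close>
  have "M <#> N = M"
  proof
    show "M <#> N \<subseteq> M"
      using \<open>N \<subseteq> M\<close> subgroup.m_closed[OF M] by (auto simp: set_mult_def)
    show "M \<subseteq> M <#> N"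
    proof
      fix m assume "m \<in> M"
      then show "m \<in> M <#> N"
        unfolding set_mult_def
        using subgroup.one_closed[OF N] r_one[of m] subgroup.mem_carrier[OF M] by force
    qed
  qed
  moreover have "M <#> (N #> z) = (M <#> N) #> z"
    by (intro setmult_rcos_assoc subgroup.subset N M z)
  ultimately show ?thesis
    by simp
qed

text \<open>A class in the image is a cycle of \<open>S\<close> modulo boundaries of
  \<open>T\<close>, since the chain map of the inclusion is the identity. The ambient
  \<open>U\<close> is left free so that the groups of two different functions can be put into the
  same quotient setting.\<close>

lemma persistent_image_eq:
  assumes "comm_group G" and "S \<subseteq> T" "T \<subseteq> U"
  shows "(ghomology_group G k (subtopology X T))
      \<lparr>carrier := ghom_induced G k (subtopology X T) id ` carrier (ghomology_group G k (subtopology X S))\<rparr> =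
    (gchain_group G k (subtopology X U) Mod gboundaries G k (subtopology X T))
      \<lparr>carrier := r_coset (gchain_group G k (subtopology X U)) (gboundaries G k (subtopology X T))
         ` gcycles G k (subtopology X S)\<rparr>"
proof -
  let ?C = "gchain_group G k (subtopology X T)"
  let ?N = "gboundaries G k (subtopology X S)" and ?M = "gboundaries G k (subtopology X T)"
  interpret C: comm_group ?C
    by (rule comm_group_gchain_group) fact
  have N: "subgroup ?N ?C"
    using assms subgroup_gboundaries subgroup_gchain_group_subtopology by blast
  have M: "subgroup ?M ?C"
    using assms subgroup_gboundaries by blast
  have "ghom_induced G k (subtopology X T) id (?N #>\<^bsub>?C\<^esub> z) = ?M #>\<^bsub>?C\<^esub> z"
    if "z \<in> gcycles G k (subtopology X S)" for z
  proof -
    have z: "z \<in> carrier ?C"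
      using that gcycles_mono[OF \<open>S \<subseteq> T\<close>, of G k X] by (auto simp: gcycles_def)
    have "?N #>\<^bsub>?C\<^esub> z \<subseteq> carrier ?C"
      using C.r_coset_subset_G[OF subgroup.subset[OF N] z] .
    then have "extend_coeffs G (chain_map (nat k) id) ` (?N #>\<^bsub>?C\<^esub> z) = ?N #>\<^bsub>?C\<^esub> z"
      using extend_coeffs_chain_map_id[OF assms(1)] by force
    moreover have "?M <#>\<^bsub>?C\<^esub> (?N #>\<^bsub>?C\<^esub> z) = ?M #>\<^bsub>?C\<^esub> z"
      using N M gboundaries_mono[OF \<open>S \<subseteq> T\<close>] z by (rule C.set_mult_r_coset_absorb)
    ultimately show ?thesis
      by (simp add: ghom_induced_def)
  qed
  moreover have "carrier (ghomology_group G k (subtopology X S)) =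
      r_coset ?C ?N ` gcycles G k (subtopology X S)"
    by (auto simp: ghomology_group_def FactGroup_def RCOSETS_def r_coset_def)
  ultimately have "ghom_induced G k (subtopology X T) id ` carrier (ghomology_group G k (subtopology X S)) =
      r_coset ?C ?M ` gcycles G k (subtopology X S)"
    by (simp add: image_image)
  \<comment> \<open>Cosets see only the pointwise multiplication, so changing the ambient chain
    group does not change them.\<close>
  also have "\<dots> = r_coset (gchain_group G k (subtopology X U)) ?M ` gcycles G k (subtopology X S)"
    by (simp add: r_coset_def)
  finally show ?thesis
    by (simp add: ghomology_group_def FactGroup_def set_mult_def fun_eq_iff)
qed

text \<open>Inside the image of \<open>Z'\<close> in \<open>C Mod N\<close> lies the image of
  \<open>Z\<close>, and the projection from \<open>C Mod N\<close> to \<open>C Mod M\<close> carries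
  it onto the image of \<open>Z\<close> there.\<close>

lemma subgroup_surjects_FactGroup:
  assumes "comm_group C" and N: "subgroup N C" and M: "subgroup M C" and "N \<subseteq> M"
    and Z: "subgroup Z C" and Z': "subgroup Z' C" and "Z \<subseteq> Z'"
  shows "subgroup_surjects ((C Mod N)\<lparr>carrier := r_coset C N ` Z'\<rparr>)
           ((C Mod M)\<lparr>carrier := r_coset C M ` Z\<rparr>)"
proof -
  interpret C: comm_group C by fact
  interpret N: normal N C by (rule C.normal_iff_subgroup[THEN iffD2]) fact
  interpret M: normal M C by (rule C.normal_iff_subgroup[THEN iffD2]) fact
  interpret hom: group_hom C "C Mod N" "r_coset C N"
    by (simp add: group_hom_def group_hom_axioms_def C.is_group N.factorgroup_is_group
        N.r_coset_hom_Mod)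
  have MN: "M <#>\<^bsub>C\<^esub> (N #>\<^bsub>C\<^esub> z) = M #>\<^bsub>C\<^esub> z" if "z \<in> carrier C" for z
    using N M \<open>N \<subseteq> M\<close> that by (rule C.set_mult_r_coset_absorb)
  have sub: "Z \<subseteq> carrier C"
    using Z by (rule subgroup.subset)
  have "subgroup (r_coset C N ` Z) ((C Mod N)\<lparr>carrier := r_coset C N ` Z'\<rparr>)"
    by (intro group.subgroup_incl N.factorgroup_is_group hom.subgroup_img_is_subgroup Z Z'
        image_mono \<open>Z \<subseteq> Z'\<close>)
  moreover have "(\<lambda>A. M <#>\<^bsub>C\<^esub> A) \<in> epi ((C Mod N)\<lparr>carrier := r_coset C N ` Z\<rparr>)
      ((C Mod M)\<lparr>carrier := r_coset C M ` Z\<rparr>)"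
  proof -
    have "M <#>\<^bsub>C\<^esub> ((N #>\<^bsub>C\<^esub> x) <#>\<^bsub>C\<^esub> (N #>\<^bsub>C\<^esub> y)) =
        (M <#>\<^bsub>C\<^esub> (N #>\<^bsub>C\<^esub> x)) <#>\<^bsub>C\<^esub> (M <#>\<^bsub>C\<^esub> (N #>\<^bsub>C\<^esub> y))"
      if "x \<in> carrier C" "y \<in> carrier C" for x y
    proof -
      have "M <#>\<^bsub>C\<^esub> ((N #>\<^bsub>C\<^esub> x) <#>\<^bsub>C\<^esub> (N #>\<^bsub>C\<^esub> y)) = M #>\<^bsub>C\<^esub> (x \<otimes>\<^bsub>C\<^esub> y)"
        using that by (simp only: N.rcos_sum MN C.m_closed)
      then show ?thesis
        using that by (simp only: M.rcos_sum MN)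
    qed
    then have "(\<lambda>A. M <#>\<^bsub>C\<^esub> A) \<in> hom ((C Mod N)\<lparr>carrier := r_coset C N ` Z\<rparr>)
        ((C Mod M)\<lparr>carrier := r_coset C M ` Z\<rparr>)"
      using subsetD[OF sub] MN by (intro homI; clarsimp simp: FactGroup_def)
    moreover have "(\<lambda>A. M <#>\<^bsub>C\<^esub> A) ` r_coset C N ` Z = r_coset C M ` Z"
      unfolding image_image using sub MN by (intro image_cong) auto
    ultimately show ?thesis
      by (simp add: epi_def)
  qed
  ultimately show ?thesis
    unfolding subgroup_surjects_def by auto
qed

section \<open>Sublevel sets of nearby functions, and the distance\<close>

lemma subgroup_surjects_persistent_homology:
  fixes \<phi> \<psi> :: "'a \<Rightarrow> real ^ 'n"
  assumes "comm_group G" and uv: "(u, v) \<in> Delta_plus"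
    and close: "\<And>x i. x \<in> topspace X \<Longrightarrow> \<bar>\<phi> x $ i - \<psi> x $ i\<bar> \<le> \<epsilon>"
  shows "subgroup_surjects (persistent_homology G k X \<phi> (u, v))
           (persistent_homology G k X \<psi> (u - vec \<epsilon>, v + vec \<epsilon>))"
proof -
  define L where "L = (\<lambda>(\<phi> :: 'a \<Rightarrow> real ^ 'n) u. {x \<in> topspace X. \<forall>i. \<phi> x $ i \<le> u $ i})"
  have sublevel_L: "sublevel X f w = subtopology X (L f w)" for f :: "'a \<Rightarrow> real ^ 'n" and w
    by (simp add: sublevel_def L_def)
  have uv': "u $ i \<le> v $ i" for i
    using uv by (simp add: Delta_plus_def less_imp_le)
  have 1: "L \<psi> (u - vec \<epsilon>) \<subseteq> L \<phi> u"
  proof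
    fix x assume x: "x \<in> L \<psi> (u - vec \<epsilon>)"
    have "\<phi> x $ i \<le> u $ i" for i
    proof -
      have "\<psi> x $ i \<le> u $ i - \<epsilon>" using x by (simp add: L_def)
      moreover have "\<bar>\<phi> x $ i - \<psi> x $ i\<bar> \<le> \<epsilon>" using close x by (simp add: L_def)
      ultimately show ?thesis by linarith
    qed
    then show "x \<in> L \<phi> u" using x by (simp add: L_def)
  qed
  have 2: "L \<phi> u \<subseteq> L \<phi> v"
    using uv' by (auto simp: L_def intro: order_trans)
  have 3: "L \<phi> v \<subseteq> L \<psi> (v + vec \<epsilon>)"
  proof
    fix x assume x: "x \<in> L \<phi> v"
    have "\<psi> x $ i \<le> v $ i + \<epsilon>" for i
    proof -
      have "\<phi> x $ i \<le> v $ i" using x by (simp add: L_def)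
      moreover have "\<bar>\<phi> x $ i - \<psi> x $ i\<bar> \<le> \<epsilon>" using close x by (simp add: L_def)
      ultimately show ?thesis by linarith
    qed
    then show "x \<in> L \<psi> (v + vec \<epsilon>)" using x by (simp add: L_def)
  qed
  have 13: "L \<phi> u \<subseteq> L \<psi> (v + vec \<epsilon>)" and 14: "L \<psi> (u - vec \<epsilon>) \<subseteq> L \<psi> (v + vec \<epsilon>)"
    using 1 2 3 by auto
  note to_top = subgroup_gchain_group_subtopology[OF \<open>comm_group G\<close>]
  show ?thesis
    \<comment> \<open>Both groups are expressed in the chain group of
      \<open>L \<psi> (v + vec \<epsilon>)\<close>; for \<psi> this is already the larger set of the
      pair, hence \<open>order_refl\<close>. Then \<open>Z\<close> and \<open>Z'\<close> are the
      cycles of \<open>L \<psi> (u - vec \<epsilon>)\<close> and \<open>L \<phi> u\<close>, while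
      \<open>N\<close> and \<open>M\<close> are the boundaries of \<open>L \<phi> v\<close> and
      \<open>L \<psi> (v + vec \<epsilon>)\<close>.\<close>
    unfolding persistent_homology_def sublevel_L prod.case
      persistent_image_eq[OF \<open>comm_group G\<close> 2 3] persistent_image_eq[OF \<open>comm_group G\<close> 14 order_refl]
    by (intro subgroup_surjects_FactGroup comm_group_gchain_group assms gboundaries_mono gcycles_mono
        to_top[OF 3] to_top[OF 13] to_top[OF 14] subgroup_gboundaries subgroup_gcycles 1 3)
qed

text \<open>Compactness bounds the norms from above, which is what makes the real supremum an upper
  bound.\<close>

lemma component_le_maxnorm_on:
  fixes f :: "'a \<Rightarrow> real ^ 'n"
  assumes "compact_space X" "continuous_map X euclidean f" "x \<in> topspace X"
  shows "\<bar>f x $ i\<bar> \<le> maxnorm_on X f"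
proof -
  have "compact (f ` topspace X)"
    using image_compactin[of X "topspace X" euclidean f] assms by (simp add: compact_space_def)
  then have "compact (infnorm ` f ` topspace X)"
    by (intro compact_continuous_image continuous_intros)
  then have "bdd_above ((\<lambda>x. infnorm (f x)) ` topspace X)"
    by (simp add: image_image bounded_imp_bdd_above compact_imp_bounded)
  then have "infnorm (f x) \<le> maxnorm_on X f"
    using assms(3) by (auto simp: maxnorm_on_def intro: cSUP_upper)
  then show ?thesis
    using Basis_le_infnorm[of "axis i 1" "f x"] by (simp add: cart_eq_inner_axis axis_in_Basis_iff)
qed

theorem corollary2p10:
  fixes G :: "('g, 'm) monoid_scheme"
    and X :: "'a topology"
    and \<phi> \<psi> :: "'a \<Rightarrow> real ^ 'n"
    and k :: int
  assumes "comm_group G"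
    and "compact_space X"
    and "continuous_map X euclidean \<phi>"
    and "continuous_map X euclidean \<psi>"
  shows "dT (persistent_homology G k X \<phi>) (persistent_homology G k X \<psi>)
           \<le> ereal (maxnorm_on X (\<lambda>x. \<phi> x - \<psi> x))"
proof -
  let ?E = "dT_set (persistent_homology G k X \<phi>) (persistent_homology G k X \<psi>)"
  let ?\<epsilon> = "maxnorm_on X (\<lambda>x. \<phi> x - \<psi> x)"
  have cont: "continuous_map X euclidean (\<lambda>x. \<phi> x - \<psi> x)"
    using assms(3,4) by (rule continuous_map_diff)
  have close: "\<bar>\<phi> x $ i - \<psi> x $ i\<bar> \<le> ?\<epsilon>" "\<bar>\<psi> x $ i - \<phi> x $ i\<bar> \<le> ?\<epsilon>"
    if "x \<in> topspace X" for x i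
    using component_le_maxnorm_on[OF assms(2) cont that, of i] by (simp_all add: abs_minus_commute)
  have nonneg: "0 \<le> ?\<epsilon>"
  proof (cases "topspace X = {}")
    case True
    then show ?thesis by (simp add: maxnorm_on_def)
  next
    case False
    then show ?thesis using close(1) by (meson abs_ge_zero all_not_in_conv order_trans)
  qed
  \<comment> \<open>The two conditions are the same lemma with \<phi> and \<psi> exchanged, hence
    the two forms of \<open>close\<close>.\<close>
  have "?\<epsilon> \<in> ?E"
    unfolding dT_set_def
    using nonneg subgroup_surjects_persistent_homology[OF assms(1)] close by blast
  \<comment> \<open>Membership excludes the value \<infinity>, and the lower bound 0 makes the real
    infimum at most each element.\<close>
  moreover have "bdd_below ?E"
    by (auto simp: dT_set_def)
  ultimately show ?thesis
    by (auto simp: dT_def intro: cInf_lower)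
qed

end
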